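(* Let $\mathcal{G}$ be a finite groupoid, $K$ a commutative ring, $R$ an associative unital $K$-algebra, and $\beta=(\{E_g\}_{g\in\mathcal{G}},\{\beta_g\}_{g\in\mathcal{G}})$ a unital action of $\mathcal{G}$ on $R$ with $R=\bigoplus_{e\in\mathcal{G}_0}E_e$. Suppose that $R$ is a $\beta$-Galois extension of $R^{\beta}$. For a wide subgroupoid $\mathcal{H}$ of $\mathcal{G}$, let $\langle S_{\mathcal{H}}\rangle$ be the subgroupoid of $\mathcal{G}$ generated by the elements of $S_{\mathcal{H}}=\{g\in\mathcal{H}\mid J_g\neq\{0\}\}$. If $\langle S_{\mathcal{H}}\rangle=\mathcal{H}$ for each wide subgroupoid $\mathcal{H}$ of $\mathcal{G}$, then the Galois map $\theta:\mathcal{H}\mapsto R^{\beta_{\mathcal{H}}}$, defined on the set of wide subgroupoids of $\mathcal{G}$, is injective.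
   Context: A groupoid $\mathcal{G}$ is a small category in which every morphism is invertible; it is identified with its set of morphisms, and is finite if this set is finite. $d(g)$, $r(g)$ are the domain and range of $g$, $\mathcal{G}_0$ is the set of objects, identified with the identity morphisms; $gh$ is defined iff $d(g)=r(h)$. A subgroupoid is a non-empty subset closed under (defined) products and inverses; a subgroupoid $\mathcal{H}$ is wide if $\mathcal{H}_0=\mathcal{G}_0$. An action $\beta=(\{E_g\},\{\beta_g\})$ of $\mathcal{G}$ on $R$: for each $g$, $E_g=E_{r(g)}$ is an ideal of $R$ and $\beta_g:E_{g^{-1}}\to E_g$ is a $K$-algebra isomorphism, with $\beta_e=\mathrm{Id}_{E_e}$ for $e\in\mathcal{G}_0$ and $\beta_g(\beta_h(r))=\beta_{gh}(r)$ whenever $d(g)=r(h)$ and $r\in E_{h^{-1}}=E_{(gh)^{-1}}$. It is unital if each $E_g$ has an identity element, denoted $1_g$. Invariants: $R^{\beta}=\{r\in R\mid \beta_g(r1_{g^{-1}})=r1_g \text{ for all } g\in\mathcal{G}\}$. For a wide subgroupoid $\mathcal{H}$, $\beta_{\mathcal{H}}=\{\beta_h\mid h\in\mathcal{H}\}$ is an action of $\mathcal{H}$ on $R$ and $R^{\beta_{\mathcal{H}}}=\{r\in R\mid \beta_h(r1_{h^{-1}})=r1_h \text{ for all } h\in\mathcal{H}\}$. $R$ is a $\beta$-Galois extension of $R^{\beta}$ if there are $x_i,y_i\in R$, $1\le i\le m$, with $\sum_i x_i\beta_g(y_i1_{g^{-1}})=\sum_{e\in\mathcal{G}_0}\delta_{e,g}1_e$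 for all $g\in\mathcal{G}$. For $g\in\mathcal{G}$, $J_g=\{r\in E_g\mid r\beta_g(x1_{g^{-1}})=xr \text{ for all } x\in R\}$. *)

theory Defs
  imports "HOL-Algebra.Algebra"
begin

section \<open>Groupoids\<close>

text \<open>
  A groupoid is given by its set of morphisms. Objects are identified with identity morphisms, so
  \<open>gdom g\<close> and \<open>gran g\<close> are themselves morphisms, and \<open>gcomp g h\<close> is meaningful only if
  \<open>gdom g = gran h\<close>.
\<close>

record 'g groupoid = "'g partial_object" +
  gdom :: "'g \<Rightarrow> 'g"
  gran :: "'g \<Rightarrow> 'g"
  gcomp :: "'g \<Rightarrow> 'g \<Rightarrow> 'g"

locale groupoid =
  fixes G :: "('g, 'm) groupoid_scheme"
  assumes dom_closed: "g \<in> carrier G \<Longrightarrow> gdom G g \<in> carrier G"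
    and ran_closed: "g \<in> carrier G \<Longrightarrow> gran G g \<in> carrier G"
    and dom_dom: "g \<in> carrier G \<Longrightarrow> gdom G (gdom G g) = gdom G g"
    and ran_dom: "g \<in> carrier G \<Longrightarrow> gran G (gdom G g) = gdom G g"
    and dom_ran: "g \<in> carrier G \<Longrightarrow> gdom G (gran G g) = gran G g"
    and ran_ran: "g \<in> carrier G \<Longrightarrow> gran G (gran G g) = gran G g"
    and comp_closed:
      "\<lbrakk>g \<in> carrier G; h \<in> carrier G; gdom G g = gran G h\<rbrakk> \<Longrightarrow> gcomp G g h \<in> carrier G"
    and dom_comp:
      "\<lbrakk>g \<in> carrier G; h \<in> carrier G; gdom G g = gran G h\<rbrakk> \<Longrightarrow> gdom G (gcomp G g h) = gdom G h"
    and ran_comp: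
      "\<lbrakk>g \<in> carrier G; h \<in> carrier G; gdom G g = gran G h\<rbrakk> \<Longrightarrow> gran G (gcomp G g h) = gran G g"
    and comp_assoc:
      "\<lbrakk>g \<in> carrier G; h \<in> carrier G; k \<in> carrier G; gdom G g = gran G h; gdom G h = gran G k\<rbrakk>
        \<Longrightarrow> gcomp G (gcomp G g h) k = gcomp G g (gcomp G h k)"
    and comp_dom: "g \<in> carrier G \<Longrightarrow> gcomp G g (gdom G g) = g"
    and ran_comp_id: "g \<in> carrier G \<Longrightarrow> gcomp G (gran G g) g = g"
    and invertible:
      "g \<in> carrier G \<Longrightarrow> \<exists>h\<in>carrier G. gdom G h = gran G g \<and> gran G h = gdom G g
        \<and> gcomp G h g = gdom G g \<and> gcomp G g h = gran G g"

definition ginv :: "('g, 'm) groupoid_scheme \<Rightarrow> 'g \<Rightarrow> 'g" where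
  "ginv G g = (THE h. h \<in> carrier G \<and> gdom G h = gran G g \<and> gran G h = gdom G g
     \<and> gcomp G h g = gdom G g \<and> gcomp G g h = gran G g)"

definition gobjs :: "('g, 'm) groupoid_scheme \<Rightarrow> 'g set" where
  "gobjs G = gdom G ` carrier G"

definition subgroupoid :: "'g set \<Rightarrow> ('g, 'm) groupoid_scheme \<Rightarrow> bool" where
  "subgroupoid H G \<longleftrightarrow> H \<subseteq> carrier G \<and> H \<noteq> {}
     \<and> (\<forall>g\<in>H. \<forall>h\<in>H. gdom G g = gran G h \<longrightarrow> gcomp G g h \<in> H)
     \<and> (\<forall>g\<in>H. ginv G g \<in> H)"

definition wide_subgroupoid :: "'g set \<Rightarrow> ('g, 'm) groupoid_scheme \<Rightarrow> bool" where
  "wide_subgroupoid H G \<longleftrightarrow> subgroupoid H G \<and> gobjs (G\<lparr>carrier := H\<rparr>) = gobjs G"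

text \<open>For non-empty \<open>S\<close> this intersection is the smallest subgroupoid containing \<open>S\<close>.\<close>

definition generated_subgroupoid :: "('g, 'm) groupoid_scheme \<Rightarrow> 'g set \<Rightarrow> 'g set" where
  "generated_subgroupoid G S = \<Inter>{T. subgroupoid T G \<and> S \<subseteq> T}"


section \<open>Algebras, ideals and direct sums\<close>

text \<open>The library's locale \<open>algebra\<close> only covers commutative algebras.\<close>

locale assoc_algebra = module K R + ring R
  for K :: "('k, 'n) ring_scheme" and R :: "('k, 'r, 'p) module_scheme" +
  assumes smult_mult_left:
      "\<lbrakk>a \<in> carrier K; x \<in> carrier R; y \<in> carrier R\<rbrakk>
        \<Longrightarrow> (a \<odot>\<^bsub>R\<^esub> x) \<otimes>\<^bsub>R\<^esub> y = a \<odot>\<^bsub>R\<^esub> (x \<otimes>\<^bsub>R\<^esub> y)"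
    and smult_mult_right:
      "\<lbrakk>a \<in> carrier K; x \<in> carrier R; y \<in> carrier R\<rbrakk>
        \<Longrightarrow> x \<otimes>\<^bsub>R\<^esub> (a \<odot>\<^bsub>R\<^esub> y) = a \<odot>\<^bsub>R\<^esub> (x \<otimes>\<^bsub>R\<^esub> y)"

definition is_ideal_one :: "('r, 'p) ring_scheme \<Rightarrow> 'r set \<Rightarrow> 'r \<Rightarrow> bool" where
  "is_ideal_one R I u \<longleftrightarrow> u \<in> I \<and> (\<forall>a\<in>I. u \<otimes>\<^bsub>R\<^esub> a = a \<and> a \<otimes>\<^bsub>R\<^esub> u = a)"

definition ideal_one :: "('r, 'p) ring_scheme \<Rightarrow> 'r set \<Rightarrow> 'r" where
  "ideal_one R I = (THE u. is_ideal_one R I u)"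

text \<open>
  Isomorphisms between ideals regarded as algebras in their own right, so no condition on \<open>\<one>\<^bsub>R\<^esub>\<close>.
  Ideals of a unital algebra are automatically closed under scalars.
\<close>

definition ideal_alg_iso ::
  "('k, 'n) ring_scheme \<Rightarrow> ('k, 'r, 'p) module_scheme \<Rightarrow> 'r set \<Rightarrow> 'r set \<Rightarrow> ('r \<Rightarrow> 'r) \<Rightarrow> bool" where
  "ideal_alg_iso K R I J f \<longleftrightarrow> bij_betw f I J
     \<and> (\<forall>x\<in>I. \<forall>y\<in>I. f (x \<oplus>\<^bsub>R\<^esub> y) = f x \<oplus>\<^bsub>R\<^esub> f y)
     \<and> (\<forall>x\<in>I. \<forall>y\<in>I. f (x \<otimes>\<^bsub>R\<^esub> y) = f x \<otimes>\<^bsub>R\<^esub> f y)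
     \<and> (\<forall>a\<in>carrier K. \<forall>x\<in>I. f (a \<odot>\<^bsub>R\<^esub> x) = a \<odot>\<^bsub>R\<^esub> f x)"

text \<open>
  Internal direct sum over a finite index set (\<open>finsum\<close> is \<open>\<zero>\<close> over infinite ones): every element
  is a sum of elements of the summands in exactly one way.
\<close>

definition internal_direct_sum :: "('r, 'p) ring_scheme \<Rightarrow> 'i set \<Rightarrow> ('i \<Rightarrow> 'r set) \<Rightarrow> bool" where
  "internal_direct_sum R I E \<longleftrightarrow> finite I \<and> (\<forall>i\<in>I. additive_subgroup (E i) R)
     \<and> (\<forall>x\<in>carrier R. \<exists>!f. f \<in> (\<Pi>\<^sub>E i\<in>I. E i) \<and> x = finsum R f I)"


section \<open>Groupoid actions and Galois extensions\<close>

locale groupoid_action = groupoid G + assoc_algebra K R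
  for G :: "('g, 'm) groupoid_scheme"
    and K :: "('k, 'n) ring_scheme"
    and R :: "('k, 'r, 'p) module_scheme"
    and E :: "'g \<Rightarrow> 'r set"
    and \<beta> :: "'g \<Rightarrow> 'r \<Rightarrow> 'r" +
  assumes E_ideal: "g \<in> carrier G \<Longrightarrow> ideal (E g) R"
    and E_ran: "g \<in> carrier G \<Longrightarrow> E g = E (gran G g)"
    and \<beta>_iso: "g \<in> carrier G \<Longrightarrow> ideal_alg_iso K R (E (ginv G g)) (E g) (\<beta> g)"
    and \<beta>_id: "\<lbrakk>e \<in> gobjs G; x \<in> E e\<rbrakk> \<Longrightarrow> \<beta> e x = x"
    and \<beta>_comp: "\<lbrakk>g \<in> carrier G; h \<in> carrier G; gdom G g = gran G h; x \<in> E (ginv G h)\<rbrakk>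
        \<Longrightarrow> \<beta> g (\<beta> h x) = \<beta> (gcomp G g h) x"

locale unital_groupoid_action = groupoid_action G K R E \<beta>
  for G :: "('g, 'm) groupoid_scheme"
    and K :: "('k, 'n) ring_scheme"
    and R :: "('k, 'r, 'p) module_scheme"
    and E :: "'g \<Rightarrow> 'r set"
    and \<beta> :: "'g \<Rightarrow> 'r \<Rightarrow> 'r" +
  assumes E_unital: "g \<in> carrier G \<Longrightarrow> \<exists>u. is_ideal_one R (E g) u"

text \<open>
  The invariants of the restriction of the action to a wide subgroupoid \<open>H\<close>; \<open>H = carrier G\<close> gives
  the invariants of the action itself.
\<close>

definition action_invariants ::
  "('g, 'm) groupoid_scheme \<Rightarrow> ('r, 'p) ring_scheme \<Rightarrow> ('g \<Rightarrow> 'r set) \<Rightarrow> ('g \<Rightarrow> 'r \<Rightarrow> 'r)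
    \<Rightarrow> 'g set \<Rightarrow> 'r set" where
  "action_invariants G R E \<beta> H = {x \<in> carrier R. \<forall>h\<in>H.
     \<beta> h (x \<otimes>\<^bsub>R\<^esub> ideal_one R (E (ginv G h))) = x \<otimes>\<^bsub>R\<^esub> ideal_one R (E h)}"

definition galois_extension ::
  "('g, 'm) groupoid_scheme \<Rightarrow> ('r, 'p) ring_scheme \<Rightarrow> ('g \<Rightarrow> 'r set) \<Rightarrow> ('g \<Rightarrow> 'r \<Rightarrow> 'r) \<Rightarrow> bool"
where
  "galois_extension G R E \<beta> \<longleftrightarrow> (\<exists>(m::nat) x y.
     x \<in> {1..m} \<rightarrow> carrier R \<and> y \<in> {1..m} \<rightarrow> carrier R \<and>
     (\<forall>g\<in>carrier G.
        (\<Oplus>\<^bsub>R\<^esub>i\<in>{1..m}. x i \<otimes>\<^bsub>R\<^esub> \<beta> g (y i \<otimes>\<^bsub>R\<^esub> ideal_one R (E (ginv G g))))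
        = (\<Oplus>\<^bsub>R\<^esub>e\<in>gobjs G. if e = g then ideal_one R (E e) else \<zero>\<^bsub>R\<^esub>)))"

definition J_set ::
  "('g, 'm) groupoid_scheme \<Rightarrow> ('r, 'p) ring_scheme \<Rightarrow> ('g \<Rightarrow> 'r set) \<Rightarrow> ('g \<Rightarrow> 'r \<Rightarrow> 'r)
    \<Rightarrow> 'g \<Rightarrow> 'r set" where
  "J_set G R E \<beta> g = {r \<in> E g. \<forall>x\<in>carrier R.
     r \<otimes>\<^bsub>R\<^esub> \<beta> g (x \<otimes>\<^bsub>R\<^esub> ideal_one R (E (ginv G g))) = x \<otimes>\<^bsub>R\<^esub> r}"

definition S_set ::
  "('g, 'm) groupoid_scheme \<Rightarrow> ('r, 'p) ring_scheme \<Rightarrow> ('g \<Rightarrow> 'r set) \<Rightarrow> ('g \<Rightarrow> 'r \<Rightarrow> 'r)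
    \<Rightarrow> 'g set \<Rightarrow> 'g set" where
  "S_set G R E \<beta> H = {g \<in> H. J_set G R E \<beta> g \<noteq> {\<zero>\<^bsub>R\<^esub>}}"

end

theory Submission
  imports Defs
begin

text \<open>
  Write \<open>act g x\<close> for \<open>\<beta>\<^sub>g(x1\<^bsub>g\<^sup>-\<^sup>1\<^esub>)\<close>, and let \<open>x\<^sub>i, y\<^sub>i\<close> be Galois coordinates. Put
  \<open>\<phi>\<^sub>h(z) = \<Sum>\<^sub>i x\<^sub>i z act h y\<^sub>i\<close>. If \<open>z\<close> commutes with the invariants of a wide subgroupoid \<open>H\<close>, it
  commutes with the traces \<open>\<Sum>\<^bsub>h\<in>H\<^esub> act h y\<^sub>i\<close>, and the Galois equations give
  \<open>\<Sum>\<^bsub>h\<in>H\<^esub> \<phi>\<^sub>h(z) = z\<close>. On the other hand \<open>\<phi>\<^sub>h\<close> kills \<open>J\<^sub>g\<close> for \<open>g \<noteq> h\<close>. Elements of \<open>J\<^sub>g\<close> with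
  \<open>g \<in> L\<close> commute with the invariants of \<open>L\<close>, so if \<open>H\<close> and \<open>L\<close> have the same invariants, then
  \<open>g \<in> L\<close> and \<open>J\<^sub>g \<noteq> 0\<close> force \<open>g \<in> H\<close>. Hence \<open>S\<^sub>H = S\<^sub>L\<close>, and \<open>H = L\<close>.
\<close>

section \<open>Interchange of finite sums\<close>

lemma (in abelian_monoid) finsum_swap:
  assumes "finite A" "finite B" "\<And>a b. \<lbrakk>a \<in> A; b \<in> B\<rbrakk> \<Longrightarrow> f a b \<in> carrier G"
  shows "(\<Oplus>a\<in>A. \<Oplus>b\<in>B. f a b) = (\<Oplus>b\<in>B. \<Oplus>a\<in>A. f a b)"
  using assms(1,3)
proof (induction A rule: finite_induct)
  case (insert a A)
  then have cl: "(\<lambda>b. f a b) \<in> B \<rightarrow> carrier G" "(\<lambda>b. \<Oplus>a\<in>A. f a b) \<in> B \<rightarrow> carrier G"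
    "(\<lambda>a. \<Oplus>b\<in>B. f a b) \<in> A \<rightarrow> carrier G"
    by (auto intro!: finsum_closed)
  have "(\<Oplus>a\<in>insert a A. \<Oplus>b\<in>B. f a b) = (\<Oplus>b\<in>B. f a b) \<oplus> (\<Oplus>a\<in>A. \<Oplus>b\<in>B. f a b)"
    by (rule finsum_insert[OF insert(1,2) cl(3) finsum_closed[OF cl(1)]])
  also have "\<dots> = (\<Oplus>b\<in>B. f a b) \<oplus> (\<Oplus>b\<in>B. \<Oplus>a\<in>A. f a b)"
    using insert.IH insert.prems by simp
  also have "\<dots> = (\<Oplus>b\<in>B. f a b \<oplus> (\<Oplus>a\<in>A. f a b))"
    by (rule finsum_addf[OF cl(1,2), symmetric])
  also have "\<dots> = (\<Oplus>b\<in>B. \<Oplus>a\<in>insert a A. f a b)"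
  proof (rule finsum_cong')
    fix b assume "b \<in> B"
    then show "f a b \<oplus> (\<Oplus>a\<in>A. f a b) = (\<Oplus>a\<in>insert a A. f a b)"
      using insert by (intro finsum_insert[symmetric]) auto
  qed (use insert.prems in \<open>auto intro!: finsum_closed\<close>)
  finally show ?case .
qed simp

section \<open>Inverses, cancellation and wide subgroupoids\<close>

context groupoid
begin

text \<open>The definite description in \<open>ginv\<close> is justified by uniqueness: for two
  inverses \<open>k\<close> and \<open>h\<close> of \<open>g\<close>,
  \<open>k = k (g h) = (k g) h = h\<close>.\<close>

lemma ginv_props:
  assumes g: "g \<in> carrier G"
  shows "ginv G g \<in> carrier G" "gdom G (ginv G g) = gran G g" "gran G (ginv G g) = gdom G g"
    "gcomp G (ginv G g) g = gdom G g" "gcomp G g (ginv G g) = gran G g"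
proof -
  let ?P = "\<lambda>h. h \<in> carrier G \<and> gdom G h = gran G g \<and> gran G h = gdom G g
     \<and> gcomp G h g = gdom G g \<and> gcomp G g h = gran G g"
  obtain h where h: "?P h" using invertible[OF g] by blast
  have "k = h" if k: "?P k" for k
  proof -
    have "k = gcomp G k (gran G g)" using comp_dom[of k] k by simp
    also have "\<dots> = gcomp G (gcomp G k g) h" using comp_assoc[of k g h] k h g by simp
    also have "\<dots> = h" using ran_comp_id[of h] k h by simp
    finally show ?thesis .
  qed
  with h have "?P (ginv G g)" unfolding ginv_def by (intro theI[of ?P h]) blast+
  then show "ginv G g \<in> carrier G" "gdom G (ginv G g) = gran G g" "gran G (ginv G g) = gdom G g"
    "gcomp G (ginv G g) g = gdom G g" "gcomp G g (ginv G g) = gran G g" by auto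
qed

text \<open>Together with the next lemma: left translation by \<open>g\<close> is a bijection from
  the morphisms with range \<open>gdom G g\<close> onto those with range \<open>gran G g\<close>.
  This reindexes the trace sums below.\<close>

lemma gcomp_ginv_cancel:
  assumes "g \<in> carrier G" "h \<in> carrier G" "gran G g = gran G h"
  shows "gcomp G g (gcomp G (ginv G g) h) = h"
  using comp_assoc[of g "ginv G g" h] assms ginv_props[of g] ran_comp_id[of h] by simp

lemma ginv_gcomp_cancel:
  assumes "g \<in> carrier G" "h \<in> carrier G" "gdom G g = gran G h"
  shows "gcomp G (ginv G g) (gcomp G g h) = h"
  using comp_assoc[of "ginv G g" g h] assms ginv_props[of g] ran_comp_id[of h] by simp

lemma gobjsD:
  assumes "e \<in> gobjs G"
  shows "e \<in> carrier G" "gdom G e = e" "gran G e = e"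
  using assms dom_closed dom_dom ran_dom by (auto simp: gobjs_def)

lemma gran_gobjs: "g \<in> carrier G \<Longrightarrow> gran G g \<in> gobjs G"
  unfolding gobjs_def using dom_ran ran_closed by (metis imageI)

lemma gdom_gobjs: "g \<in> carrier G \<Longrightarrow> gdom G g \<in> gobjs G"
  unfolding gobjs_def by blast

lemma wide_subgroupoidD:
  assumes "wide_subgroupoid H G"
  shows "H \<subseteq> carrier G" "gobjs G \<subseteq> H"
    "\<lbrakk>g \<in> H; h \<in> H; gdom G g = gran G h\<rbrakk> \<Longrightarrow> gcomp G g h \<in> H"
    "g \<in> H \<Longrightarrow> ginv G g \<in> H"
proof -
  have H: "H \<subseteq> carrier G" "\<And>g h. \<lbrakk>g \<in> H; h \<in> H; gdom G g = gran G h\<rbrakk> \<Longrightarrow> gcomp G g h \<in> H"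
     "\<And>g. g \<in> H \<Longrightarrow> ginv G g \<in> H" "gdom G ` H = gobjs G"
    using assms by (simp_all add: wide_subgroupoid_def subgroupoid_def gobjs_def)
  \<comment> \<open>The domain is the product of \<open>ginv G g\<close> and \<open>g\<close>, so
    closure of \<open>H\<close> puts it in \<open>H\<close>.\<close>
  have "gdom G g \<in> H" if "g \<in> H" for g
    using H(2)[OF H(3)[OF that] that] ginv_props[of g] H(1) that by auto
  then have "gdom G ` H \<subseteq> H" by (rule image_subsetI)
  then show "gobjs G \<subseteq> H" by (simp add: H(4))
qed (use assms in \<open>simp_all add: wide_subgroupoid_def subgroupoid_def\<close>)

end

section \<open>The ideals \<open>E g\<close> and their identity elements\<close>

locale direct_sum_groupoid_action = unital_groupoid_action G K R E \<beta>
  for G :: "('g, 'm) groupoid_scheme"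
    and K :: "('k, 'n) ring_scheme"
    and R :: "('k, 'r, 'p) module_scheme" (structure)
    and E :: "'g \<Rightarrow> 'r set"
    and \<beta> :: "'g \<Rightarrow> 'r \<Rightarrow> 'r" +
  assumes finite_G: "finite (carrier G)"
    and direct_sum: "internal_direct_sum R (gobjs G) E"
begin

definition unit_of :: "'g \<Rightarrow> 'r" where
  "unit_of g = ideal_one R (E g)"

text \<open>A total version of \<open>\<beta> g\<close>: projection of \<open>R\<close> onto
  \<open>E (gdom G g)\<close>, followed by \<open>\<beta> g\<close>. It is additive and
  multiplicative on all of \<open>R\<close>, which allows calculation without domain
  conditions.\<close>

definition act :: "'g \<Rightarrow> 'r \<Rightarrow> 'r" where
  "act g x = \<beta> g (x \<otimes> ideal_one R (E (ginv G g)))"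

lemma finite_gobjs: "finite (gobjs G)"
  using finite_G by (simp add: gobjs_def)

lemma E_subset: "\<lbrakk>g \<in> carrier G; x \<in> E g\<rbrakk> \<Longrightarrow> x \<in> carrier R"
  using ideal.Icarr[OF E_ideal] .

lemma E_zero: "g \<in> carrier G \<Longrightarrow> \<zero> \<in> E g"
  using E_ideal additive_subgroup.zero_closed ideal.axioms(1) by blast

lemma E_mult:
  assumes "g \<in> carrier G" "a \<in> E g" "x \<in> carrier R"
  shows "a \<otimes> x \<in> E g" "x \<otimes> a \<in> E g"
  using ideal.I_r_closed[OF E_ideal] ideal.I_l_closed[OF E_ideal] assms by auto

lemma unit_of_ideal_one:
  assumes g: "g \<in> carrier G"
  shows "is_ideal_one R (E g) (unit_of g)"
proof -
  obtain u where u: "is_ideal_one R (E g) u" using E_unital[OF g] by blast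
  then have "v = u" if "is_ideal_one R (E g) v" for v
    using that unfolding is_ideal_one_def by metis
  with u show ?thesis unfolding unit_of_def ideal_one_def by (rule theI)
qed

lemma unit_of_E: "g \<in> carrier G \<Longrightarrow> unit_of g \<in> E g"
  using unit_of_ideal_one by (simp add: is_ideal_one_def)

lemma unit_of_closed [simp]: "g \<in> carrier G \<Longrightarrow> unit_of g \<in> carrier R"
  using unit_of_E E_subset by blast

lemma unit_of_neutral:
  assumes "g \<in> carrier G" "a \<in> E g"
  shows "unit_of g \<otimes> a = a" "a \<otimes> unit_of g = a"
  using unit_of_ideal_one[of g] assms by (auto simp: is_ideal_one_def)

text \<open>For \<open>u = unit_of g\<close>, both \<open>u x\<close> and \<open>x u\<close> lie in
  the ideal \<open>E g\<close>, where \<open>u\<close> is neutral, so both equal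
  \<open>u x u\<close>.\<close>

lemma unit_of_central:
  assumes "g \<in> carrier G" "x \<in> carrier R"
  shows "unit_of g \<otimes> x = x \<otimes> unit_of g"
proof -
  have "unit_of g \<otimes> x = unit_of g \<otimes> x \<otimes> unit_of g"
    using unit_of_neutral E_mult unit_of_E assms by simp
  also have "\<dots> = unit_of g \<otimes> (x \<otimes> unit_of g)" using assms by (simp add: m_assoc)
  also have "\<dots> = x \<otimes> unit_of g" using unit_of_neutral E_mult unit_of_E assms by simp
  finally show ?thesis .
qed

lemma E_ginv: "g \<in> carrier G \<Longrightarrow> E (ginv G g) = E (gdom G g)"
  using E_ran[of "ginv G g"] ginv_props[of g] by simp

lemma unit_of_ran: "g \<in> carrier G \<Longrightarrow> unit_of (gran G g) = unit_of g"
  using E_ran[of g] by (simp add: unit_of_def)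

text \<open>Placing \<open>x\<close> in coordinate \<open>e\<close> and placing it in coordinate
  \<open>f\<close> give two decompositions of \<open>x\<close>. By uniqueness they agree, and
  coordinate \<open>e\<close> reads \<open>x = \<zero>\<close>.\<close>

lemma E_disjoint:
  assumes e: "e \<in> gobjs G" and f: "f \<in> gobjs G" and "e \<noteq> f" and x: "x \<in> E e" "x \<in> E f"
  shows "x = \<zero>"
proof -
  have xR: "x \<in> carrier R" using E_subset gobjsD(1)[OF e] x by blast
  let ?F = "\<lambda>e. restrict (\<lambda>i. if e = i then x else \<zero>) (gobjs G)"
  have 1: "finsum R (?F i) (gobjs G) = x" if "i \<in> gobjs G" for i
  proof -
    have "finsum R (?F i) (gobjs G) = (\<Oplus>j\<in>gobjs G. if i = j then x else \<zero>)"
      by (rule finsum_cong') (use xR in auto)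
    also have "\<dots> = x" using finsum_singleton[OF that finite_gobjs, of "\<lambda>_. x"] xR by simp
    finally show ?thesis .
  qed
  have 2: "?F i \<in> (\<Pi>\<^sub>E i\<in>gobjs G. E i)" if "x \<in> E i" "i \<in> gobjs G" for i
    using that E_zero gobjsD(1) by auto
  have "\<exists>!F. F \<in> (\<Pi>\<^sub>E i\<in>gobjs G. E i) \<and> x = finsum R F (gobjs G)"
    using direct_sum xR by (auto simp: internal_direct_sum_def)
  then have "?F e = ?F f" using 1[OF e] 1[OF f] 2[OF x(1) e] 2[OF x(2) f] by metis
  then have "?F e e = ?F f e" by (rule arg_cong)
  with e \<open>e \<noteq> f\<close> show ?thesis by simp
qed

text \<open>The product lies in both two-sided ideals, which are distinct summands and meet only in
  zero.\<close>

lemma E_orthogonal: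
  assumes "g \<in> carrier G" "h \<in> carrier G" "gran G g \<noteq> gran G h" "x \<in> E g" "y \<in> E h"
  shows "x \<otimes> y = \<zero>"
proof (rule E_disjoint[OF gran_gobjs[OF assms(1)] gran_gobjs[OF assms(2)] assms(3)])
  show "x \<otimes> y \<in> E (gran G g)" using assms E_mult E_subset E_ran[of g] by metis
  show "x \<otimes> y \<in> E (gran G h)" using assms E_mult E_subset E_ran[of h] by metis
qed

text \<open>Decompose \<open>\<one>\<close> as the sum of components \<open>F i\<close>. Multiplying
  by \<open>unit_of e\<close> kills every component except \<open>F e\<close>, by orthogonality, so
  \<open>F e = unit_of e\<close>.\<close>

lemma sum_unit_of: "(\<Oplus>e\<in>gobjs G. unit_of e) = \<one>"
proof -
  have "\<exists>!F. F \<in> (\<Pi>\<^sub>E i\<in>gobjs G. E i) \<and> \<one> = finsum R F (gobjs G)"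
    using direct_sum by (auto simp: internal_direct_sum_def)
  then obtain F where F: "F \<in> (\<Pi>\<^sub>E i\<in>gobjs G. E i)" "\<one> = finsum R F (gobjs G)" by blast
  have FE: "F i \<in> E i" if "i \<in> gobjs G" for i using F that by auto
  have FR: "F \<in> gobjs G \<rightarrow> carrier R" using FE E_subset gobjsD(1) by blast
  have "unit_of e = F e" if e: "e \<in> gobjs G" for e
  proof -
    have eG: "e \<in> carrier G" using gobjsD(1)[OF e] .
    have "unit_of e = finsum R F (gobjs G) \<otimes> unit_of e" using F(2)[symmetric] eG by simp
    also have "\<dots> = (\<Oplus>i\<in>gobjs G. F i \<otimes> unit_of e)"
      using finsum_ldistr[OF finite_gobjs] FR eG by simp
    also have "\<dots> = (\<Oplus>i\<in>gobjs G. if e = i then F i else \<zero>)"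
    proof (rule finsum_cong')
      fix i assume i: "i \<in> gobjs G"
      show "F i \<otimes> unit_of e = (if e = i then F i else \<zero>)"
        using E_orthogonal[of i e] unit_of_neutral(2)[OF eG] FE[OF i] unit_of_E[OF eG]
          gobjsD[OF e] gobjsD[OF i] by auto
    qed (use FR in auto)
    also have "\<dots> = F e" using finsum_singleton[OF e finite_gobjs FR] .
    finally show ?thesis .
  qed
  then have "(\<Oplus>e\<in>gobjs G. unit_of e) = finsum R F (gobjs G)"
    using FR by (intro finsum_cong') auto
  with F(2) show ?thesis by simp
qed

section \<open>The total maps \<open>act g\<close>\<close>

lemma act_alt: "g \<in> carrier G \<Longrightarrow> act g x = \<beta> g (x \<otimes> unit_of (gdom G g))"
  by (simp add: act_def unit_of_def E_ginv)

lemma \<beta>_props: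
  assumes g: "g \<in> carrier G"
  shows "x \<in> E (gdom G g) \<Longrightarrow> \<beta> g x \<in> E g"
    "\<lbrakk>x \<in> E (gdom G g); y \<in> E (gdom G g)\<rbrakk> \<Longrightarrow> \<beta> g (x \<oplus> y) = \<beta> g x \<oplus> \<beta> g y"
    "\<lbrakk>x \<in> E (gdom G g); y \<in> E (gdom G g)\<rbrakk> \<Longrightarrow> \<beta> g (x \<otimes> y) = \<beta> g x \<otimes> \<beta> g y"
  using \<beta>_iso[OF g] E_ginv[OF g] by (auto simp: ideal_alg_iso_def bij_betw_def)

lemma mult_unit_of_dom: "\<lbrakk>g \<in> carrier G; x \<in> carrier R\<rbrakk> \<Longrightarrow> x \<otimes> unit_of (gdom G g) \<in> E (gdom G g)"
  using E_mult(2) unit_of_E dom_closed by blast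

lemma act_E: "\<lbrakk>g \<in> carrier G; x \<in> carrier R\<rbrakk> \<Longrightarrow> act g x \<in> E g"
  by (simp add: act_alt \<beta>_props(1) mult_unit_of_dom)

lemma act_closed [simp]: "\<lbrakk>g \<in> carrier G; x \<in> carrier R\<rbrakk> \<Longrightarrow> act g x \<in> carrier R"
  using act_E E_subset by blast

lemma act_add:
  assumes "g \<in> carrier G" "x \<in> carrier R" "y \<in> carrier R"
  shows "act g (x \<oplus> y) = act g x \<oplus> act g y"
  using assms by (simp add: act_alt \<beta>_props(2)[symmetric] mult_unit_of_dom l_distr dom_closed)

lemma act_mult:
  assumes "g \<in> carrier G" "x \<in> carrier R" "y \<in> carrier R"
  shows "act g (x \<otimes> y) = act g x \<otimes> act g y"
proof -
  let ?u = "unit_of (gdom G g)"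
  have u: "gdom G g \<in> carrier G" "?u \<in> carrier R" using dom_closed assms by auto
  have "x \<otimes> ?u \<otimes> (y \<otimes> ?u) = x \<otimes> (?u \<otimes> (y \<otimes> ?u))" using assms u by (simp add: m_assoc)
  also have "?u \<otimes> (y \<otimes> ?u) = y \<otimes> ?u"
    using unit_of_neutral(1)[OF u(1)] mult_unit_of_dom assms by simp
  finally have "x \<otimes> y \<otimes> ?u = x \<otimes> ?u \<otimes> (y \<otimes> ?u)" using assms u by (simp add: m_assoc)
  then show ?thesis using assms by (simp add: act_alt \<beta>_props(3)[symmetric] mult_unit_of_dom)
qed

lemma act_zero [simp]:
  assumes "g \<in> carrier G"
  shows "act g \<zero> = \<zero>"
  using act_add[OF assms zero_closed zero_closed] act_closed[OF assms zero_closed]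
  by (simp add: add.l_cancel_one')

lemma act_finsum:
  assumes "g \<in> carrier G" "finite A" "f \<in> A \<rightarrow> carrier R"
  shows "act g (finsum R f A) = (\<Oplus>i\<in>A. act g (f i))"
  using assms(2,3)
proof (induction A rule: finite_induct)
  case (insert a A)
  then have "(\<lambda>i. act g (f i)) \<in> A \<rightarrow> carrier R" by (intro Pi_I act_closed assms) auto
  with insert show ?case using assms(1) by (auto simp: act_add)
qed (use assms in simp)

lemma act_gobjs:
  assumes "e \<in> gobjs G" "x \<in> carrier R"
  shows "act e x = x \<otimes> unit_of e"
  using assms gobjsD[of e] \<beta>_id[of e "x \<otimes> unit_of e"] mult_unit_of_dom[of e x]
  by (simp add: act_alt)

text \<open>Undefined products act as zero: if \<open>gdom G g\<close> and \<open>gran G h\<close>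
  differ, the image of \<open>act h\<close> lies in \<open>E h\<close>, which is orthogonal to
  \<open>E (gdom G g)\<close>.\<close>

lemma act_act:
  assumes g: "g \<in> carrier G" and h: "h \<in> carrier G" and x: "x \<in> carrier R"
  shows "act g (act h x) = (if gdom G g = gran G h then act (gcomp G g h) x else \<zero>)"
proof (cases "gdom G g = gran G h")
  case True
  have "act h x \<otimes> unit_of (gdom G g) = act h x"
    using unit_of_neutral(2)[OF h] act_E[OF h x] True unit_of_ran[OF h] by simp
  then have "act g (act h x) = \<beta> g (\<beta> h (x \<otimes> unit_of (gdom G h)))"
    using g h by (simp add: act_alt)
  also have "\<dots> = act (gcomp G g h) x"
    using \<beta>_comp[OF g h True, of "x \<otimes> unit_of (gdom G h)"] mult_unit_of_dom[OF h x] E_ginv[OF h]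
      comp_closed[OF g h True] dom_comp[OF g h True] by (simp add: act_alt)
  finally show ?thesis using True by simp
next
  case False
  have d: "gdom G g \<in> carrier G" using dom_closed[OF g] .
  have "act h x \<otimes> unit_of (gdom G g) = \<zero>"
    using E_orthogonal[OF h d _ act_E[OF h x] unit_of_E[OF d]] False ran_dom[OF g] by simp
  then have "act g (act h x) = act g \<zero>" using g d by (simp add: act_alt)
  with False g show ?thesis by simp
qed

section \<open>Invariants, traces and the sets \<open>J_set\<close>\<close>

lemma mem_invariants_iff:
  "x \<in> action_invariants G R E \<beta> H
    \<longleftrightarrow> x \<in> carrier R \<and> (\<forall>h\<in>H. act h x = x \<otimes> unit_of h)"
  by (simp add: action_invariants_def act_def unit_of_def)

lemma mem_J_set_iff:
  "r \<in> J_set G R E \<beta> g \<longleftrightarrow> r \<in> E g \<and> (\<forall>x\<in>carrier R. r \<otimes> act g x = x \<otimes> r)"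
  by (simp add: J_set_def act_def)

text \<open>Applying \<open>act k\<close> keeps the terms with range \<open>gdom G k\<close> and
  translates them onto the terms with range \<open>gran G k\<close>. Multiplying by
  \<open>unit_of k\<close> selects exactly the latter.\<close>

lemma trace_invariant:
  assumes H: "wide_subgroupoid H G" and y: "y \<in> carrier R"
  shows "(\<Oplus>h\<in>H. act h y) \<in> action_invariants G R E \<beta> H"
proof -
  note W = wide_subgroupoidD[OF H]
  have fin: "finite H" using finite_subset[OF W(1) finite_G] .
  have HG: "h \<in> H \<Longrightarrow> h \<in> carrier G" for h using W(1) by blast
  have cl: "(\<lambda>h. act h y) \<in> H \<rightarrow> carrier R" using HG y by auto
  have "act k (\<Oplus>h\<in>H. act h y) = (\<Oplus>h\<in>H. act h y) \<otimes> unit_of k" if k: "k \<in> H" for k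
  proof -
    let ?A = "{h \<in> H. gdom G k = gran G h}" and ?B = "{h \<in> H. gran G h = gran G k}"
    have kG: "k \<in> carrier G" using HG[OF k] .
    have "act k (\<Oplus>h\<in>H. act h y) = (\<Oplus>h\<in>H. act k (act h y))"
      using act_finsum[OF kG fin cl] .
    also have "\<dots> = (\<Oplus>h\<in>?A. act k (act h y))"
      by (rule add.finprod_mono_neutral_cong_right) (use fin kG HG y in \<open>auto simp: act_act comp_closed\<close>)
    also have "\<dots> = (\<Oplus>h\<in>?A. act (gcomp G k h) y)"
      by (rule finsum_cong') (use kG HG y in \<open>auto simp: act_act comp_closed\<close>)
    also have "\<dots> = (\<Oplus>h\<in>gcomp G k ` ?A. act h y)"
    proof (rule finsum_reindex[symmetric])
      show "inj_on (gcomp G k) ?A"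
        by (rule inj_on_inverseI[where g = "gcomp G (ginv G k)"])
          (use kG HG ginv_gcomp_cancel in auto)
    qed (use kG HG y in \<open>auto simp: comp_closed\<close>)
    \<comment> \<open>The preimage of \<open>h\<close> is \<open>ginv G k\<close> composed with
      \<open>h\<close>, which stays in \<open>H\<close> by closure.\<close>
    also have "gcomp G k ` ?A = ?B"
    proof (intro equalityI subsetI)
      fix h assume h: "h \<in> ?B"
      have "gcomp G (ginv G k) h \<in> ?A"
        using h HG[of h] W(3)[OF W(4)[OF k], of h] ginv_props[OF kG] ran_comp[of "ginv G k" h]
        by simp
      then show "h \<in> gcomp G k ` ?A"
        using gcomp_ginv_cancel[OF kG, of h] HG[of h] h by force
    qed (use W(3)[OF k] kG HG ran_comp in auto)
    \<comment> \<open>Outside \<open>?B\<close> the factor \<open>unit_of k\<close> annihilates the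
      term by orthogonality; inside, it equals \<open>unit_of h\<close> and is neutral.\<close>
    also have "(\<Oplus>h\<in>?B. act h y) = (\<Oplus>h\<in>H. act h y \<otimes> unit_of k)"
    proof (rule add.finprod_mono_neutral_cong_left)
      fix h assume "h \<in> H - ?B"
      then show "act h y \<otimes> unit_of k = \<zero>"
        using E_orthogonal[OF HG kG _ act_E[OF HG y] unit_of_E[OF kG]] by blast
    next
      fix h assume h: "h \<in> ?B"
      then have "unit_of k = unit_of h" using unit_of_ran[OF kG] unit_of_ran[OF HG, of h] by simp
      then show "act h y = act h y \<otimes> unit_of k"
        using unit_of_neutral(2)[OF HG act_E[OF HG y]] h by simp
    qed (use fin kG HG y in auto)
    also have "\<dots> = (\<Oplus>h\<in>H. act h y) \<otimes> unit_of k"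
      using finsum_ldistr[OF fin _ cl] kG by simp
    finally show ?thesis .
  qed
  then show ?thesis using mem_invariants_iff cl finsum_closed by simp
qed

text \<open>On an invariant \<open>t\<close> the twist in the defining relation of
  \<open>J_set\<close> is only multiplication by \<open>unit_of g\<close>, which \<open>r\<close>
  absorbs because it lies in \<open>E g\<close>.\<close>

lemma J_set_commutes_invariants:
  assumes "H \<subseteq> carrier G" "g \<in> H" "r \<in> J_set G R E \<beta> g" "t \<in> action_invariants G R E \<beta> H"
  shows "r \<otimes> t = t \<otimes> r"
proof -
  have g: "g \<in> carrier G" using assms by blast
  have r: "r \<in> E g" "r \<in> carrier R" using assms(3) E_subset[OF g] by (auto simp: mem_J_set_iff)
  have t: "t \<in> carrier R" "act g t = t \<otimes> unit_of g"
    using assms mem_invariants_iff by auto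
  have "t \<otimes> r = r \<otimes> act g t" using assms(3) t(1) by (simp add: mem_J_set_iff)
  also have "\<dots> = r \<otimes> (unit_of g \<otimes> t)" using t unit_of_central[OF g] by simp
  also have "\<dots> = r \<otimes> t"
    using r t g unit_of_neutral(2)[OF g r(1)] by (simp add: m_assoc[symmetric])
  finally show ?thesis by simp
qed

section \<open>Consequences of fixed Galois coordinates\<close>

context
  fixes m :: nat and x y :: "nat \<Rightarrow> 'r"
  assumes x: "x \<in> {1..m} \<rightarrow> carrier R" and y: "y \<in> {1..m} \<rightarrow> carrier R"
    and galois: "\<And>g. g \<in> carrier G \<Longrightarrow>
      (\<Oplus>i\<in>{1..m}. x i \<otimes> act g (y i)) = (if g \<in> gobjs G then unit_of g else \<zero>)"
begin

text \<open>Moving \<open>r\<close> to the left turns \<open>x i\<close> into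
  \<open>act g (x i)\<close>. If the ranges of \<open>g\<close> and \<open>h\<close> differ, every
  product is zero by orthogonality. Otherwise \<open>h = g k\<close>, so \<open>act g\<close>
  factors out and leaves the Galois sum at \<open>k\<close>, which vanishes since \<open>k\<close>
  is not an identity.\<close>

lemma galois_projection_J_set:
  assumes g: "g \<in> carrier G" and h: "h \<in> carrier G" and "g \<noteq> h" and r: "r \<in> J_set G R E \<beta> g"
  shows "(\<Oplus>i\<in>{1..m}. x i \<otimes> r \<otimes> act h (y i)) = \<zero>"
proof -
  have xy: "x i \<in> carrier R" "y i \<in> carrier R" if "i \<in> {1..m}" for i using x y that by auto
  have rR: "r \<in> carrier R" using r E_subset[OF g] by (auto simp: mem_J_set_iff)
  have eq: "x i \<otimes> r = r \<otimes> act g (x i)" if "i \<in> {1..m}" for i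
    using r xy[OF that] by (simp add: mem_J_set_iff)
  show ?thesis
  proof (cases "gran G g = gran G h")
    case False
    have "x i \<otimes> r \<otimes> act h (y i) = \<zero>" if i: "i \<in> {1..m}" for i
      using E_orthogonal[OF g h False act_E[OF g] act_E[OF h]] xy[OF i] rR g h
      by (simp add: eq[OF i] m_assoc)
    then have "(\<Oplus>i\<in>{1..m}. x i \<otimes> r \<otimes> act h (y i)) = (\<Oplus>i\<in>{1..m}. \<zero>)"
      by (intro finsum_cong') auto
    then show ?thesis by simp
  next
    case True
    define k where "k = gcomp G (ginv G g) h"
    note inv = ginv_props[OF g]
    have kG: "k \<in> carrier G" and gk: "gdom G g = gran G k" "gdom G k = gdom G h"
      using comp_closed[of "ginv G g" h] ran_comp[of "ginv G g" h] dom_comp[of "ginv G g" h]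
        inv h True by (auto simp: k_def)
    have comp: "gcomp G g k = h" using gcomp_ginv_cancel[OF g h True] by (simp add: k_def)
    \<comment> \<open>An identity \<open>k\<close> with range \<open>gdom G g\<close> would be
      \<open>gdom G g\<close> itself, giving \<open>h = g\<close>.\<close>
    have k_obj: "k \<notin> gobjs G"
    proof
      assume "k \<in> gobjs G"
      then have "k = gdom G g" using gobjsD(3)[of k] gk by simp
      with comp_dom[OF g] comp \<open>g \<noteq> h\<close> show False by simp
    qed
    have "x i \<otimes> r \<otimes> act h (y i) = r \<otimes> act g (x i \<otimes> act k (y i))" if i: "i \<in> {1..m}" for i
      using xy[OF i] rR g h kG gk
      by (simp add: eq[OF i] m_assoc act_mult act_act comp)
    then have "(\<Oplus>i\<in>{1..m}. x i \<otimes> r \<otimes> act h (y i))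
        = (\<Oplus>i\<in>{1..m}. r \<otimes> act g (x i \<otimes> act k (y i)))"
      using xy rR g kG by (intro finsum_cong') auto
    also have "\<dots> = r \<otimes> (\<Oplus>i\<in>{1..m}. act g (x i \<otimes> act k (y i)))"
      using xy rR g kG by (intro finsum_rdistr[symmetric]) auto
    also have "\<dots> = r \<otimes> act g (\<Oplus>i\<in>{1..m}. x i \<otimes> act k (y i))"
      using xy g kG by (subst act_finsum) auto
    also have "\<dots> = \<zero>" using galois[OF kG] k_obj g rR by simp
    finally show ?thesis .
  qed
qed

text \<open>For fixed \<open>i\<close>, summing over \<open>H\<close> produces the trace of
  \<open>y i\<close>, past which \<open>z\<close> can be moved to the far right. Then the Galois
  equations apply for each \<open>h\<close> separately.\<close>

lemma sum_galois_projections: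
  assumes H: "wide_subgroupoid H G" and z: "z \<in> carrier R"
    and comm: "\<And>t. t \<in> action_invariants G R E \<beta> H \<Longrightarrow> z \<otimes> t = t \<otimes> z"
  shows "(\<Oplus>h\<in>H. \<Oplus>i\<in>{1..m}. x i \<otimes> z \<otimes> act h (y i)) = z"
proof -
  note W = wide_subgroupoidD[OF H]
  have fin: "finite H" using finite_subset[OF W(1) finite_G] .
  have HG: "h \<in> H \<Longrightarrow> h \<in> carrier G" for h using W(1) by blast
  have xy: "x i \<in> carrier R" "y i \<in> carrier R" if "i \<in> {1..m}" for i using x y that by auto
  have tr: "(\<Oplus>h\<in>H. x i \<otimes> z \<otimes> act h (y i)) = (\<Oplus>h\<in>H. x i \<otimes> act h (y i) \<otimes> z)"
    if i: "i \<in> {1..m}" for i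
  proof -
    let ?t = "\<Oplus>h\<in>H. act h (y i)"
    have cl: "(\<lambda>h. act h (y i)) \<in> H \<rightarrow> carrier R" using HG xy[OF i] by auto
    then have t: "?t \<in> carrier R" by (rule finsum_closed)
    have "(\<Oplus>h\<in>H. x i \<otimes> z \<otimes> act h (y i)) = x i \<otimes> z \<otimes> ?t"
      using finsum_rdistr[OF fin _ cl] xy[OF i] z by simp
    also have "\<dots> = x i \<otimes> ?t \<otimes> z"
      using comm[OF trace_invariant[OF H xy(2)[OF i]]] xy[OF i] z t by (simp add: m_assoc)
    also have "x i \<otimes> ?t = (\<Oplus>h\<in>H. x i \<otimes> act h (y i))"
      using finsum_rdistr[OF fin _ cl] xy[OF i] by simp
    also have "\<dots> \<otimes> z = (\<Oplus>h\<in>H. x i \<otimes> act h (y i) \<otimes> z)"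
      using HG xy[OF i] by (intro finsum_ldistr[OF fin z]) auto
    finally show ?thesis .
  qed
  have "(\<Oplus>h\<in>H. \<Oplus>i\<in>{1..m}. x i \<otimes> z \<otimes> act h (y i))
      = (\<Oplus>i\<in>{1..m}. \<Oplus>h\<in>H. x i \<otimes> z \<otimes> act h (y i))"
    using HG xy z by (intro finsum_swap fin) auto
  also have "\<dots> = (\<Oplus>i\<in>{1..m}. \<Oplus>h\<in>H. x i \<otimes> act h (y i) \<otimes> z)"
    by (rule finsum_cong'[OF refl _ tr]) (use HG xy z in \<open>auto intro!: finsum_closed\<close>)
  also have "\<dots> = (\<Oplus>h\<in>H. \<Oplus>i\<in>{1..m}. x i \<otimes> act h (y i) \<otimes> z)"
    using HG xy z by (intro finsum_swap[symmetric] fin) auto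
  also have "\<dots> = (\<Oplus>h\<in>H. (if h \<in> gobjs G then unit_of h else \<zero>) \<otimes> z)"
  proof (rule finsum_cong')
    fix h assume h: "h \<in> H"
    have "(\<Oplus>i\<in>{1..m}. x i \<otimes> act h (y i) \<otimes> z) = (\<Oplus>i\<in>{1..m}. x i \<otimes> act h (y i)) \<otimes> z"
      using HG[OF h] xy z by (intro finsum_ldistr[symmetric]) auto
    then show "(\<Oplus>i\<in>{1..m}. x i \<otimes> act h (y i) \<otimes> z)
        = (if h \<in> gobjs G then unit_of h else \<zero>) \<otimes> z"
      by (simp only: galois[OF HG[OF h]])
  qed (use HG z in auto)
  also have "\<dots> = (\<Oplus>h\<in>H. if h \<in> gobjs G then unit_of h else \<zero>) \<otimes> z"
    using HG by (intro finsum_ldistr[OF fin z, symmetric]) auto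
  \<comment> \<open>Wideness enters here: \<open>H\<close> contains every identity of
    \<open>G\<close>, so the full sum of the units, namely \<open>\<one>\<close>, remains.\<close>
  also have "(\<Oplus>h\<in>H. if h \<in> gobjs G then unit_of h else \<zero>) = (\<Oplus>h\<in>gobjs G. unit_of h)"
    by (rule add.finprod_mono_neutral_cong_right) (use fin W(2) HG in auto)
  finally show ?thesis using sum_unit_of z by simp
qed

text \<open>A nonzero \<open>r\<close> in \<open>J_set G R E \<beta> g\<close> detects whether
  \<open>g\<close> lies in \<open>H\<close>: it is the sum of its projections over \<open>H\<close>,
  and all of these vanish if \<open>g\<close> is missing from \<open>H\<close>.\<close>

lemma S_set_subset_of_invariants_eq:
  assumes H: "wide_subgroupoid H G" and L: "wide_subgroupoid L G"
    and eq: "action_invariants G R E \<beta> H = action_invariants G R E \<beta> L"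
  shows "S_set G R E \<beta> L \<subseteq> S_set G R E \<beta> H"
proof
  fix g assume g: "g \<in> S_set G R E \<beta> L"
  note LG = wide_subgroupoidD(1)[OF L] and HG = wide_subgroupoidD(1)[OF H]
  have gL: "g \<in> L" and gG: "g \<in> carrier G" and J: "J_set G R E \<beta> g \<noteq> {\<zero>}"
    using g LG by (auto simp: S_set_def)
  \<comment> \<open>This excludes an empty \<open>J_set\<close>, so being different from
    \<open>{\<zero>}\<close> yields a nonzero element.\<close>
  have "\<zero> \<in> J_set G R E \<beta> g" using gG E_zero by (simp add: mem_J_set_iff)
  with J obtain r where r: "r \<in> J_set G R E \<beta> g" "r \<noteq> \<zero>" by blast
  have rR: "r \<in> carrier R" using r E_subset[OF gG] by (simp add: mem_J_set_iff)
  have "g \<in> H"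
  proof (rule ccontr)
    assume "g \<notin> H"
    then have "(\<Oplus>i\<in>{1..m}. x i \<otimes> r \<otimes> act h (y i)) = \<zero>" if "h \<in> H" for h
      using galois_projection_J_set[OF gG _ _ r(1)] HG that by blast
    then have "(\<Oplus>h\<in>H. \<Oplus>i\<in>{1..m}. x i \<otimes> r \<otimes> act h (y i)) = (\<Oplus>h\<in>H. \<zero>)"
      by (intro finsum_cong') auto
    then have "r = \<zero>"
      using sum_galois_projections[OF H rR J_set_commutes_invariants[OF LG gL r(1)]] eq by simp
    with r show False by simp
  qed
  with J show "g \<in> S_set G R E \<beta> H" by (simp add: S_set_def)
qed

end

section \<open>Recovering a wide subgroupoid from its invariants\<close>

lemma S_set_eq_of_invariants_eq:
  assumes gal: "galois_extension G R E \<beta>"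
    and H: "wide_subgroupoid H G" and L: "wide_subgroupoid L G"
    and eq: "action_invariants G R E \<beta> H = action_invariants G R E \<beta> L"
  shows "S_set G R E \<beta> H = S_set G R E \<beta> L"
proof -
  \<comment> \<open>Evaluates the Kronecker sum of the Galois condition, giving the case distinction
    used with the coordinates above.\<close>
  have delta: "(\<Oplus>e\<in>gobjs G. if e = g then ideal_one R (E e) else \<zero>)
      = (if g \<in> gobjs G then unit_of g else \<zero>)" if "g \<in> carrier G" for g
  proof (cases "g \<in> gobjs G")
    case True
    have "(\<Oplus>e\<in>gobjs G. if e = g then ideal_one R (E e) else \<zero>)
        = (\<Oplus>e\<in>gobjs G. if g = e then unit_of e else \<zero>)"
      by (rule finsum_cong') (use gobjsD(1) in \<open>auto simp: unit_of_def[symmetric]\<close>)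
    also have "\<dots> = unit_of g"
      by (rule finsum_singleton[OF True finite_gobjs]) (use gobjsD(1) in auto)
    finally show ?thesis using True by simp
  next
    case False
    then have "(\<Oplus>e\<in>gobjs G. if e = g then ideal_one R (E e) else \<zero>) = (\<Oplus>e\<in>gobjs G. \<zero>)"
      by (intro finsum_cong') auto
    with False show ?thesis by simp
  qed
  obtain m :: nat and x y where xy: "x \<in> {1..m} \<rightarrow> carrier R" "y \<in> {1..m} \<rightarrow> carrier R"
    and "\<forall>g\<in>carrier G. (\<Oplus>i\<in>{1..m}. x i \<otimes> \<beta> g (y i \<otimes> ideal_one R (E (ginv G g))))
      = (\<Oplus>e\<in>gobjs G. if e = g then ideal_one R (E e) else \<zero>)"
    using gal unfolding galois_extension_def by blast
  then have galois: "(\<Oplus>i\<in>{1..m}. x i \<otimes> act g (y i)) = (if g \<in> gobjs G then unit_of g else \<zero>)"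
    if "g \<in> carrier G" for g
    using delta that unfolding act_def by simp
  show ?thesis
    by (intro equalityI S_set_subset_of_invariants_eq[OF xy galois] H L eq eq[symmetric])
qed

end

theorem theorem4p4:
  fixes G :: "('g, 'm) groupoid_scheme"
    and K :: "('k, 'n) ring_scheme"
    and R :: "('k, 'r, 'p) module_scheme"
    and E :: "'g \<Rightarrow> 'r set"
    and \<beta> :: "'g \<Rightarrow> 'r \<Rightarrow> 'r"
  assumes "finite (carrier G)"
    and "unital_groupoid_action G K R E \<beta>"
    and "internal_direct_sum R (gobjs G) E"
    and "galois_extension G R E \<beta>"
    and "\<And>H. wide_subgroupoid H G \<Longrightarrow> generated_subgroupoid G (S_set G R E \<beta> H) = H"
  shows "inj_on (\<lambda>H. action_invariants G R E \<beta> H) {H. wide_subgroupoid H G}"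
proof (rule inj_onI)
  interpret direct_sum_groupoid_action G K R E \<beta>
    using assms(1-3) by (simp add: direct_sum_groupoid_action_def direct_sum_groupoid_action_axioms_def)
  fix H L assume "H \<in> {H. wide_subgroupoid H G}" "L \<in> {H. wide_subgroupoid H G}"
    and eq: "action_invariants G R E \<beta> H = action_invariants G R E \<beta> L"
  then have HL: "wide_subgroupoid H G" "wide_subgroupoid L G" by auto
  \<comment> \<open>Both subgroupoids are generated by the same set.\<close>
  have "H = generated_subgroupoid G (S_set G R E \<beta> H)" by (rule assms(5)[OF HL(1), symmetric])
  also have "S_set G R E \<beta> H = S_set G R E \<beta> L" by (rule S_set_eq_of_invariants_eq[OF assms(4) HL eq])
  also have "generated_subgroupoid G \<dots> = L" by (rule assms(5)[OF HL(2)])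
  finally show "H = L" .
qed

end
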